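(* Let $G$ be a residue graph with respect to a positive integer $r$ and a finite graph $M=M(G)$ on vertex set $\{0,1,\dots,r-1\}$, and let $Q$ be the uniform distribution on $\{0,1,\dots,r-1\}$. Then $$\lim_{n\to\infty}\frac1n\log_2 T_G(n)=C(M(G),Q).$$
   Context: Here $\mathbb{N}=\{1,2,3,\dots\}$ and $[n]=\{1,\dots,n\}$. For a graph $G$ on vertex set $\mathbb{N}$, two permutations $\pi,\sigma$ of $[n]$ are $G$-different if there is $i\in[n]$ such that $\{\pi(i),\sigma(i)\}$ is an edge of $G$; $T_G(n)$ is the maximum cardinality of a set of permutations of $[n]$ any two distinct members of which are $G$-different. $G$ is a residue graph with respect to $r$ and $M$ (a finite graph on $\{0,\dots,r-1\}$) if for all $a,b\in\mathbb{N}$: $\{a,b\}\in E(G)$ iff $\{a \bmod r, b\bmod r\}\in E(M)$. For a finite graph $M$ with vertex set $V$: sequences $\mathbf x,\mathbf y\in V^n$ are $M$-different if $\{x_i,y_i\}\in E(M)$ for some $i$. The type of $\mathbf x\in V^n$ is the distribution $P_{\mathbf x}(a)=\frac1n|\{i: x_i=a\}|$. For a distribution $P$ on $V$ and $\varepsilon>0$, $V^n(P,\varepsilon)=\{\mathbf x\in V^n:\max_{a\in V}|P_{\mathbf x}(a)-P(a)|\le\varepsilon\}$, and $\omega(M,P,\varepsilon,n)$ is the largest cardinality of a subset of $V^n(P,\varepsilon)$ of pairwise $M$-different sequences. The capacity of $M$ within type $P$ is $C(M,P)=\lim_{\varepsilon\to0}\limsup_{n\to\infty}\frac1n\log_2\omega(M,P,\varepsilon,n)$.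 *)

theory Defs
  imports "HOL-Probability.Probability_Mass_Function" "HOL-Combinatorics.Permutations"
begin

text \<open>A graph is given by its vertex set and its set of edges, which are two-element sets of
  vertices. The sets \<open>\<nat>\<close> and \<open>[n]\<close> of the mathematical text start at 1: they are \<open>{1..}\<close> and
  \<open>{1..n}\<close> here.\<close>

definition simple_graph :: "'a set \<Rightarrow> 'a set set \<Rightarrow> bool" where
  "simple_graph V E \<longleftrightarrow> (\<forall>e\<in>E. e \<subseteq> V \<and> card e = 2)"

definition residue_graph :: "nat set set \<Rightarrow> nat \<Rightarrow> nat set set \<Rightarrow> bool" where
  "residue_graph G r M \<longleftrightarrow>
     simple_graph {1..} G \<and> simple_graph {0..<r} M \<and>
     (\<forall>a\<in>{1..}. \<forall>b\<in>{1..}. {a, b} \<in> G \<longleftrightarrow> {a mod r, b mod r} \<in> M)"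

text \<open>The same relation serves for permutations of \<open>{1..n}\<close> and for sequences of length \<open>n\<close>, the
  latter being functions in \<open>{1..n} \<rightarrow>\<^sub>E V\<close>.\<close>

definition graph_different :: "'a set set \<Rightarrow> nat \<Rightarrow> (nat \<Rightarrow> 'a) \<Rightarrow> (nat \<Rightarrow> 'a) \<Rightarrow> bool" where
  "graph_different E n x y \<longleftrightarrow> (\<exists>i\<in>{1..n}. {x i, y i} \<in> E)"

definition max_different_perms :: "nat set set \<Rightarrow> nat \<Rightarrow> nat" where
  "max_different_perms G n =
     Max {card S | S. S \<subseteq> {\<pi>. \<pi> permutes {1..n}} \<and> pairwise (graph_different G n) S}"

definition seq_type :: "nat \<Rightarrow> (nat \<Rightarrow> 'a) \<Rightarrow> 'a \<Rightarrow> real" where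
  "seq_type n x a = real (card {i \<in> {1..n}. x i = a}) / real n"

definition typical_seqs :: "'a set \<Rightarrow> 'a pmf \<Rightarrow> real \<Rightarrow> nat \<Rightarrow> (nat \<Rightarrow> 'a) set" where
  "typical_seqs V P \<epsilon> n =
     {x \<in> {1..n} \<rightarrow>\<^sub>E V. (MAX a\<in>V. \<bar>seq_type n x a - pmf P a\<bar>) \<le> \<epsilon>}"

definition max_different_seqs :: "'a set \<Rightarrow> 'a set set \<Rightarrow> 'a pmf \<Rightarrow> real \<Rightarrow> nat \<Rightarrow> nat" where
  "max_different_seqs V E P \<epsilon> n =
     Max {card S | S. S \<subseteq> typical_seqs V P \<epsilon> n \<and> pairwise (graph_different E n) S}"

text \<open>The convention \<open>log 2 0 = 0\<close> is harmless below: for fixed \<open>\<epsilon> > 0\<close> and \<open>P\<close> supported in the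
  finite set \<open>V\<close>, \<open>typical_seqs V P \<epsilon> n\<close> is nonempty for all large \<open>n\<close>.\<close>

definition type_capacity :: "'a set \<Rightarrow> 'a set set \<Rightarrow> 'a pmf \<Rightarrow> ereal" where
  "type_capacity V E P =
     Lim (at_right 0)
       (\<lambda>\<epsilon>. limsup (\<lambda>n. ereal (1 / real n * log 2 (real (max_different_seqs V E P \<epsilon> n)))))"

text \<open>The limit defining the capacity exists.\<close>

lemma finite_card_subsets:
  assumes "finite A"
  shows "finite {card S | S. S \<subseteq> A \<and> Q S}"
proof -
  have "{card S | S. S \<subseteq> A \<and> Q S} \<subseteq> card ` Pow A" by auto
  then show ?thesis using assms finite_subset by blast
qed

lemma max_different_seqs_mono:
  assumes "finite V" "\<epsilon> \<le> \<delta>"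
  shows "max_different_seqs V E P \<epsilon> n \<le> max_different_seqs V E P \<delta> n"
proof -
  have "finite ({1..n} \<rightarrow>\<^sub>E V)" using assms by (auto intro: finite_PiE)
  then have fin: "finite (typical_seqs V P \<delta> n)" unfolding typical_seqs_def by auto
  have sub: "typical_seqs V P \<epsilon> n \<subseteq> typical_seqs V P \<delta> n"
    using assms unfolding typical_seqs_def by auto
  show ?thesis
    unfolding max_different_seqs_def
  proof (rule Max_mono)
    show "{card S | S. S \<subseteq> typical_seqs V P \<epsilon> n \<and> pairwise (graph_different E n) S}
      \<subseteq> {card S | S. S \<subseteq> typical_seqs V P \<delta> n \<and> pairwise (graph_different E n) S}"
      using sub by blast
    show "{card S | S. S \<subseteq> typical_seqs V P \<epsilon> n \<and> pairwise (graph_different E n) S} \<noteq> {}"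
      using pairwise_empty by blast
  qed (rule finite_card_subsets[OF fin])
qed

lemma tendsto_type_capacity:
  assumes "finite V"
  shows "((\<lambda>\<epsilon>. limsup (\<lambda>n. ereal (1 / real n * log 2 (real (max_different_seqs V E P \<epsilon> n)))))
    \<longlongrightarrow> type_capacity V E P) (at_right 0)"
proof -
  define f where
    "f = (\<lambda>\<epsilon>. limsup (\<lambda>n. ereal (1 / real n * log 2 (real (max_different_seqs V E P \<epsilon> n)))))"
  have mono: "f \<epsilon> \<le> f \<delta>" if "\<epsilon> \<le> \<delta>" for \<epsilon> \<delta>
    unfolding f_def
  proof (intro Limsup_mono always_eventually allI)
    fix n
    let ?a = "max_different_seqs V E P \<epsilon> n" and ?b = "max_different_seqs V E P \<delta> n"
    have le: "?a \<le> ?b" using max_different_seqs_mono[OF assms that] .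
    have "log 2 (real ?a) \<le> log 2 (real ?b)"
    proof (cases "?a = 0")
      case True
      then show ?thesis by (cases "?b = 0") (auto simp: log_def)
    next
      case False
      then show ?thesis using le by simp
    qed
    then show "ereal (1 / real n * log 2 (real ?a)) \<le> ereal (1 / real n * log 2 (real ?b))"
      by (simp add: divide_right_mono)
  qed
  have "(f \<longlongrightarrow> Inf (f ` ({0<..} \<inter> UNIV))) (at 0 within ({0<..} \<inter> UNIV))"
    by (rule Lim_right_bound[where K = bot]) (auto intro: mono)
  then have "(f \<longlongrightarrow> Inf (f ` {0<..})) (at_right 0)" by simp
  moreover from this have "Lim (at_right 0) f = Inf (f ` {0<..})"
    by (intro tendsto_Lim) auto
  ultimately show ?thesis unfolding type_capacity_def f_def by simp
qed

end

theory Submission imports Defs begin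

text \<open>Reducing values modulo \<open>r\<close> maps \<open>G\<close>-different permutations to \<open>M\<close>-different sequences of
  almost uniform type, which gives the upper bound. Conversely, an almost uniform sequence of length
  \<open>m\<close> is a prefix of the reduction of some permutation of \<open>{1..N}\<close>, where \<open>N\<close> is only slightly larger
  than \<open>m\<close> and divisible by \<open>r\<close>. Concatenation of permutations, with a shift by a multiple of \<open>r\<close>,
  makes \<open>T\<^sub>G\<close> supermultiplicative along multiples of \<open>r\<close>, so that a single good length \<open>N\<close> bounds the
  lower limit over all lengths.\<close>

section \<open>Families of pairwise different objects and their maximum sizes\<close>

text \<open>Two distinct members with the same image would make that image \<open>Q\<close>-related
  to itself, so irreflexivity of \<open>Q\<close> forces injectivity on \<open>S\<close>. Each
  comparison of maximum sizes below needs only a map that preserves difference.\<close>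

lemma pairwise_card_image:
  assumes "pairwise P S"
    and hom: "\<And>x y. x \<in> S \<Longrightarrow> y \<in> S \<Longrightarrow> P x y \<Longrightarrow> Q (h x) (h y)"
    and irrefl: "\<And>z. \<not> Q z z"
  shows "card (h ` S) = card S" "pairwise Q (h ` S)"
proof -
  have "inj_on h S"
  proof (rule inj_onI)
    fix x y assume xy: "x \<in> S" "y \<in> S" "h x = h y"
    show "x = y"
    proof (rule ccontr)
      assume "x \<noteq> y"
      then have "Q (h x) (h y)" by (intro hom pairwiseD(1)[OF assms(1)] xy)
      then show False using xy irrefl by simp
    qed
  qed
  then show "card (h ` S) = card S" by (rule card_image)
  show "pairwise Q (h ` S)"
    by (rule pairwise_imageI) (use assms(1) hom in \<open>auto simp: pairwise_def\<close>)
qed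

lemma graph_different_irrefl:
  assumes "simple_graph V E"
  shows "\<not> graph_different E n x x"
  using assms unfolding simple_graph_def graph_different_def by force

lemma card_le_max_different_perms:
  assumes "S \<subseteq> {\<pi>. \<pi> permutes {1..n}}" "pairwise (graph_different G n) S"
  shows "card S \<le> max_different_perms G n"
  unfolding max_different_perms_def
proof (rule Max_ge)
  show "finite {card S |S. S \<subseteq> {\<pi>. \<pi> permutes {1..n}} \<and> pairwise (graph_different G n) S}"
    by (rule finite_card_subsets) (simp add: finite_permutations)
qed (use assms in blast)

lemma max_different_perms_attained:
  obtains S where "S \<subseteq> {\<pi>. \<pi> permutes {1..n}}" "pairwise (graph_different G n) S"
    "card S = max_different_perms G n"
proof -
  let ?A = "{card S |S. S \<subseteq> {\<pi>. \<pi> permutes {1..n}} \<and> pairwise (graph_different G n) S}"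
  have "finite ?A"
    by (rule finite_card_subsets) (simp add: finite_permutations)
  moreover have "?A \<noteq> {}" using pairwise_empty by blast
  ultimately have "Max ?A \<in> ?A" by (rule Max_in)
  then show thesis using that unfolding max_different_perms_def by auto
qed

text \<open>A singleton family is vacuously pairwise different. Hence the logarithm of the maximum
  is nonnegative and never takes the default value at 0.\<close>

lemma max_different_perms_ge_1: "1 \<le> max_different_perms G n"
  using card_le_max_different_perms[of "{id}" n G] by (simp add: permutes_id pairwise_singleton)

definition perm_rate :: "nat set set \<Rightarrow> nat \<Rightarrow> real" where
  "perm_rate G n = 1 / real n * log 2 (real (max_different_perms G n))"

lemma log_max_different_perms_nonneg: "0 \<le> log 2 (real (max_different_perms G n))"
  using max_different_perms_ge_1[of G n] by simp

lemma finite_typical_seqs: "finite V \<Longrightarrow> finite (typical_seqs V P \<epsilon> n)"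
  unfolding typical_seqs_def by (simp add: finite_PiE)

lemma card_le_max_different_seqs:
  assumes "finite V" "S \<subseteq> typical_seqs V P \<epsilon> n" "pairwise (graph_different E n) S"
  shows "card S \<le> max_different_seqs V E P \<epsilon> n"
  unfolding max_different_seqs_def
proof (rule Max_ge)
  show "finite {card S |S. S \<subseteq> typical_seqs V P \<epsilon> n \<and> pairwise (graph_different E n) S}"
    by (rule finite_card_subsets[OF finite_typical_seqs[OF assms(1)]])
qed (use assms in blast)

lemma max_different_seqs_attained:
  assumes "finite V"
  obtains S where "S \<subseteq> typical_seqs V P \<epsilon> n" "pairwise (graph_different E n) S"
    "card S = max_different_seqs V E P \<epsilon> n"
proof -
  let ?A = "{card S |S. S \<subseteq> typical_seqs V P \<epsilon> n \<and> pairwise (graph_different E n) S}"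
  have "finite ?A" by (rule finite_card_subsets[OF finite_typical_seqs[OF assms]])
  moreover have "?A \<noteq> {}" using pairwise_empty by blast
  ultimately have "Max ?A \<in> ?A" by (rule Max_in)
  then show thesis using that unfolding max_different_seqs_def by auto
qed

section \<open>Uniform types and residue classes in an initial segment\<close>

lemma typical_seqs_uniform_iff:
  assumes "r > 0"
  shows "x \<in> typical_seqs {0..<r} (pmf_of_set {0..<r}) \<epsilon> n \<longleftrightarrow>
    x \<in> {1..n} \<rightarrow>\<^sub>E {0..<r} \<and> (\<forall>a<r. \<bar>seq_type n x a - 1 / real r\<bar> \<le> \<epsilon>)"
  using assms unfolding typical_seqs_def by (auto simp: Max_le_iff pmf_of_set)

lemma real_nat_div_bounds:
  assumes "r > 0"
  shows "real (n div r) \<le> real n / real r" "real n / real r \<le> real (n div r) + 1"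
proof -
  have "real n = real (n div r) * real r + real (n mod r)"
    by (metis div_mult_mod_eq of_nat_add of_nat_mult)
  moreover have "real (n mod r) \<le> real r" using assms by (simp add: less_imp_le)
  ultimately show "real (n div r) \<le> real n / real r" "real n / real r \<le> real (n div r) + 1"
    using assms by (simp_all add: field_simps)
qed

lemma card_residue_class_bounds:
  assumes "a < r"
  shows "n div r \<le> card {k \<in> {1..n}. k mod r = a}"
    and "card {k \<in> {1..n}. k mod r = a} \<le> n div r + 1"
proof -
  let ?C = "{k \<in> {1..n}. k mod r = a}"
  have r: "r > 0" using assms by simp
  \<comment> \<open>\<open>?f j\<close> is the element of residue \<open>a\<close> in the block
    \<open>{j * r + 1..Suc j * r}\<close>. Since the segment starts at 1, residue 0 is represented
    by the right end of the block.\<close>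
  let ?f = "\<lambda>j. j * r + (if a = 0 then r else a)"
  have "?f ` {..<n div r} \<subseteq> ?C"
  proof
    fix k assume "k \<in> ?f ` {..<n div r}"
    then obtain j where j: "j < n div r" "k = ?f j" by auto
    have "k \<le> Suc j * r" using j assms by auto
    also have "\<dots> \<le> (n div r) * r" using j by (intro mult_right_mono) auto
    also have "\<dots> \<le> n" by (simp add: div_times_less_eq_dividend)
    finally show "k \<in> ?C" using j assms by auto
  qed
  moreover have "inj_on ?f {..<n div r}" using r by (auto simp: inj_on_def)
  ultimately show "n div r \<le> card ?C"
    using card_inj_on_le[of ?f "{..<n div r}" ?C] by simp
  \<comment> \<open>Within one residue class the quotient determines the number, and only
    \<open>n div r + 1\<close> quotients occur.\<close>
  have "inj_on (\<lambda>k. k div r) ?C"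
  proof (rule inj_onI)
    fix k l assume "k \<in> ?C" "l \<in> ?C" "k div r = l div r"
    then show "k = l" using div_mult_mod_eq[of k r] div_mult_mod_eq[of l r] by simp
  qed
  moreover have "(\<lambda>k. k div r) ` ?C \<subseteq> {..n div r}" by (auto intro: div_le_mono)
  ultimately show "card ?C \<le> n div r + 1"
    using card_inj_on_le[of "\<lambda>k. k div r" ?C "{..n div r}"] by simp
qed

section \<open>Permutations with prescribed residues, and concatenation\<close>

lemma inj_on_extends_to_permutation:
  assumes "finite B" "A \<subseteq> B" "inj_on f A" "f ` A \<subseteq> B"
  obtains p where "p permutes B" "\<And>i. i \<in> A \<Longrightarrow> p i = f i"
proof -
  have "finite A" using finite_subset[OF assms(2,1)] .
  then have "card (B - A) = card (B - f ` A)"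
    using card_Diff_subset[of A B] card_Diff_subset[of "f ` A" B] card_image[OF assms(3)] assms(2,4)
    by simp
  then obtain g where g: "bij_betw g (B - A) (B - f ` A)"
    using finite_same_card_bij[of "B - A" "B - f ` A"] assms(1) by auto
  define p where "p i = (if i \<in> A then f i else if i \<in> B then g i else i)" for i
  have "bij_betw p A (f ` A)"
    using bij_betw_imageI[OF assms(3) refl] bij_betw_cong[of A p f] by (simp add: p_def)
  moreover have "bij_betw p (B - A) (B - f ` A)"
    using g bij_betw_cong[of "B - A" p g] by (simp add: p_def)
  ultimately have "bij_betw p (A \<union> (B - A)) (f ` A \<union> (B - f ` A))"
    by (rule bij_betw_combine) auto
  moreover have "A \<union> (B - A) = B" "f ` A \<union> (B - f ` A) = B" using assms(2,4) by blast+
  ultimately have "bij_betw p B B" by simp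
  moreover have "p i = i" if "i \<notin> B" for i using that assms(2) unfolding p_def by auto
  ultimately have "p permutes B" by (rule bij_imp_permutes)
  then show thesis by (rule that) (simp add: p_def)
qed

text \<open>By \<open>count\<close>, the positions where \<open>x\<close> takes the value
  \<open>a\<close> fit injectively into the numbers of residue \<open>a\<close>. Classes of
  different residues are disjoint, so these injections glue to one on \<open>{1..m}\<close>; the
  remaining positions are filled arbitrarily.\<close>

lemma permutation_with_residues:
  fixes x :: "nat \<Rightarrow> nat"
  assumes "m \<le> n" "\<And>i. i \<in> {1..m} \<Longrightarrow> x i < r"
    and count: "\<And>a. a < r \<Longrightarrow> card {i \<in> {1..m}. x i = a} \<le> n div r"
  obtains p where "p permutes {1..n}" "\<And>i. i \<in> {1..m} \<Longrightarrow> p i mod r = x i"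
proof -
  have "\<exists>g. g ` {i \<in> {1..m}. x i = a} \<subseteq> {k \<in> {1..n}. k mod r = a} \<and>
      inj_on g {i \<in> {1..m}. x i = a}" if "a < r" for a
    by (rule card_le_inj)
      (use count[OF that] card_residue_class_bounds(1)[OF that, of n] in auto)
  then have "\<exists>g. \<forall>a<r. g a ` {i \<in> {1..m}. x i = a} \<subseteq> {k \<in> {1..n}. k mod r = a} \<and>
      inj_on (g a) {i \<in> {1..m}. x i = a}"
    by (intro choice) blast
  then obtain g where g: "\<And>a. a < r \<Longrightarrow>
      g a ` {i \<in> {1..m}. x i = a} \<subseteq> {k \<in> {1..n}. k mod r = a} \<and>
      inj_on (g a) {i \<in> {1..m}. x i = a}"
    by blast
  let ?f = "\<lambda>i. g (x i) i"
  have f: "?f i \<in> {1..n} \<and> ?f i mod r = x i" if "i \<in> {1..m}" for i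
    using g[OF assms(2)[OF that]] that by blast
  have "inj_on ?f {1..m}"
  proof (rule inj_onI)
    fix i j assume ij: "i \<in> {1..m}" "j \<in> {1..m}" "?f i = ?f j"
    \<comment> \<open>Equal values have equal residues, so both positions are served by the same
      injection.\<close>
    then have eq: "x i = x j" using f by metis
    show "i = j"
      using g[OF assms(2)[OF ij(1)]] ij eq by (auto simp: inj_on_def)
  qed
  then obtain p where "p permutes {1..n}" "\<And>i. i \<in> {1..m} \<Longrightarrow> p i = ?f i"
    by (rule inj_on_extends_to_permutation[rotated 2, of _ _ "{1..n}"]) (use f assms(1) in auto)
  with f show thesis by (intro that[of p]) simp_all
qed

lemma permutes_concat:
  assumes "p permutes {1..N}" "q permutes {1..n}"
  shows "(\<lambda>i::nat. if i \<le> N then p i else N + q (i - N)) permutes {1..N + n}" (is "?t permutes _")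
proof (rule bij_imp_permutes)
  have p: "p i \<in> {1..N}" if "i \<in> {1..N}" for i using permutes_in_image[OF assms(1)] that by blast
  have q: "q i \<in> {1..n}" if "i \<in> {1..n}" for i using permutes_in_image[OF assms(2)] that by blast
  have "bij_betw ?t {1..N} {1..N}"
    using permutes_imp_bij[OF assms(1)] by (subst bij_betw_cong[of _ _ p]) auto
  \<comment> \<open>On the upper block the map is \<open>q\<close> conjugated by the shift by
    \<open>N\<close>.\<close>
  moreover have "bij_betw ?t {N + 1..N + n} {N + 1..N + n}"
  proof -
    have "bij_betw (\<lambda>i. i - N) {N + 1..N + n} {1..n}"
      by (rule bij_betw_byWitness[where f' = "\<lambda>i. N + i"]) auto
    moreover have "bij_betw (\<lambda>i. N + i) {1..n} {N + 1..N + n}"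
      by (rule bij_betw_byWitness[where f' = "\<lambda>i. i - N"]) auto
    ultimately have "bij_betw ((\<lambda>i. N + i) \<circ> (q \<circ> (\<lambda>i. i - N))) {N + 1..N + n} {N + 1..N + n}"
      using permutes_imp_bij[OF assms(2)] by (blast intro: bij_betw_trans)
    then show ?thesis by (subst bij_betw_cong) auto
  qed
  ultimately have "bij_betw ?t ({1..N} \<union> {N + 1..N + n}) ({1..N} \<union> {N + 1..N + n})"
    by (rule bij_betw_combine) auto
  moreover have "{1..N} \<union> {N + 1..N + n} = {1..N + n}" by auto
  ultimately show "bij_betw ?t {1..N + n} {1..N + n}" by simp
  show "?t i = i" if "i \<notin> {1..N + n}" for i
  proof (cases "i \<le> N")
    case True
    then show ?thesis using that permutes_not_in[OF assms(1)] by auto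
  next
    case False
    then have "i - N \<notin> {1..n}" using that by auto
    then show ?thesis using False permutes_not_in[OF assms(2)] by simp
  qed
qed

section \<open>Comparison of permutations with sequences over the residues\<close>

context
  fixes G M :: "nat set set" and r :: nat
  assumes r: "r > 0" and res: "residue_graph G r M"
begin

lemma residue_edge_iff: "a \<ge> 1 \<Longrightarrow> b \<ge> 1 \<Longrightarrow> {a, b} \<in> G \<longleftrightarrow> {a mod r, b mod r} \<in> M"
  using res unfolding residue_graph_def by auto

lemma G_irrefl: "\<not> graph_different G n x x"
  using res graph_different_irrefl unfolding residue_graph_def by blast

lemma M_irrefl: "\<not> graph_different M n x x"
  using res graph_different_irrefl unfolding residue_graph_def by blast

text \<open>Reduction modulo \<open>r\<close> turns edges of \<open>G\<close> into edges of
  \<open>M\<close>. Every residue occurs in \<open>{1..n}\<close> within 1 of \<open>n / r\<close>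
  times, so the reduced permutations have type within \<open>1 / n\<close> of uniform; the
  hypothesis says that this is at most \<epsilon>.\<close>

lemma max_different_perms_le_seqs:
  assumes n: "1 \<le> real n * \<epsilon>"
  shows "max_different_perms G n \<le> max_different_seqs {0..<r} M (pmf_of_set {0..<r}) \<epsilon> n"
proof -
  have n0: "n > 0" using n by (cases n) auto
  obtain S where S: "S \<subseteq> {\<pi>. \<pi> permutes {1..n}}" "pairwise (graph_different G n) S"
    and card: "card S = max_different_perms G n"
    by (rule max_different_perms_attained)
  \<comment> \<open>The restriction makes \<open>h p\<close> an element of
    \<open>{1..n} \<rightarrow>\<^sub>E {0..<r}\<close>.\<close>
  define h where "h p = restrict (\<lambda>i. p i mod r) {1..n}" for p :: "nat \<Rightarrow> nat"
  have hom: "graph_different M n (h p) (h q)"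
    if pq: "p \<in> S" "q \<in> S" "graph_different G n p q" for p q
  proof -
    have "p permutes {1..n}" "q permutes {1..n}" using pq S by auto
    then have pos: "p i \<ge> 1 \<and> q i \<ge> 1" if "i \<in> {1..n}" for i
      using that permutes_in_image[of p "{1..n}" i] permutes_in_image[of q "{1..n}" i] by simp
    obtain i where i: "i \<in> {1..n}" "{p i, q i} \<in> G"
      using pq(3) unfolding graph_different_def by blast
    then have "{h p i, h q i} \<in> M" using pos residue_edge_iff by (simp add: h_def)
    then show ?thesis using i(1) unfolding graph_different_def by blast
  qed
  have "h ` S \<subseteq> typical_seqs {0..<r} (pmf_of_set {0..<r}) \<epsilon> n"
  proof (intro image_subsetI)
    fix p assume "p \<in> S"
    then have p: "p permutes {1..n}" using S by auto
    have "\<bar>seq_type n (h p) a - 1 / real r\<bar> \<le> \<epsilon>" if a: "a < r" for a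
    proof -
      \<comment> \<open>A permutation only rearranges its values, so the type of \<open>h p\<close>
        is the residue statistics of \<open>{1..n}\<close>, the same for every
        \<open>p\<close>.\<close>
      have "bij_betw p {i \<in> {1..n}. h p i = a} {k \<in> {1..n}. k mod r = a}"
        unfolding bij_betw_def
      proof
        show "inj_on p {i \<in> {1..n}. h p i = a}"
          using permutes_inj[OF p] by (rule inj_on_subset) auto
        show "p ` {i \<in> {1..n}. h p i = a} = {k \<in> {1..n}. k mod r = a}"
        proof -
          have "{i \<in> {1..n}. h p i = a} = {i \<in> {1..n}. p i mod r = a}"
            by (auto simp: h_def)
          moreover have "p ` {i \<in> {1..n}. p i mod r = a} = {k \<in> p ` {1..n}. k mod r = a}"
            by blast
          ultimately show ?thesis unfolding permutes_image[OF p] by simp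
        qed
      qed
      then have eq: "seq_type n (h p) a = real (card {k \<in> {1..n}. k mod r = a}) / real n"
        unfolding seq_type_def by (simp add: bij_betw_same_card)
      let ?c = "real (card {k \<in> {1..n}. k mod r = a})"
      \<comment> \<open>The count and \<open>n / r\<close> both lie between \<open>n div r\<close>
        and \<open>n div r + 1\<close>, hence differ by at most 1.\<close>
      have "real (n div r) \<le> ?c" "?c \<le> real (n div r) + 1"
        using card_residue_class_bounds[OF a, of n] by linarith+
      with real_nat_div_bounds[OF r, of n] have c: "\<bar>?c - real n / real r\<bar> \<le> 1" by linarith
      have "?c / real n - 1 / real r = (?c - real n / real r) / real n"
        using n0 by (simp add: diff_divide_distrib)
      then have "\<bar>?c / real n - 1 / real r\<bar> = \<bar>?c - real n / real r\<bar> / real n"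
        by (simp add: abs_divide)
      also have "\<dots> \<le> 1 / real n" using c n0 by (simp add: divide_right_mono)
      also have "\<dots> \<le> \<epsilon>" using n n0 by (simp add: field_simps)
      finally show ?thesis using eq by simp
    qed
    then show "h p \<in> typical_seqs {0..<r} (pmf_of_set {0..<r}) \<epsilon> n"
      using r by (auto simp: typical_seqs_uniform_iff h_def)
  qed
  then show ?thesis
    using card_le_max_different_seqs[of "{0..<r}" "h ` S" _ \<epsilon> n M]
      pairwise_card_image[of "graph_different G n" S "graph_different M n" h, OF S(2) hom M_irrefl] card
    by simp
qed

text \<open>An \<epsilon>-typical sequence of length \<open>m\<close> uses each residue at most
  \<open>m * (1 / r + \<epsilon>)\<close> times, while \<open>{1..n}\<close> supplies each at least
  \<open>n div r\<close> times. So every such sequence lifts to a permutation of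
  \<open>{1..n}\<close> whose first \<open>m\<close> values reduce to it, and a position where two
  sequences differ along \<open>M\<close> is one where the lifts differ along
  \<open>G\<close>.\<close>

lemma max_different_seqs_le_perms:
  assumes m: "m > 0" "m \<le> n" and n: "real m * (1 / real r + \<epsilon>) \<le> real (n div r)"
  shows "max_different_seqs {0..<r} M (pmf_of_set {0..<r}) \<epsilon> m \<le> max_different_perms G n"
proof -
  obtain S where S: "S \<subseteq> typical_seqs {0..<r} (pmf_of_set {0..<r}) \<epsilon> m"
    "pairwise (graph_different M m) S"
    and card: "card S = max_different_seqs {0..<r} M (pmf_of_set {0..<r}) \<epsilon> m"
    by (rule max_different_seqs_attained[OF finite_atLeastLessThan])
  have "\<exists>p. p permutes {1..n} \<and> (\<forall>i\<in>{1..m}. p i mod r = x i)" if "x \<in> S" for x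
  proof -
    have x: "x \<in> {1..m} \<rightarrow>\<^sub>E {0..<r}"
      and near: "\<And>a. a < r \<Longrightarrow> \<bar>seq_type m x a - 1 / real r\<bar> \<le> \<epsilon>"
      using subsetD[OF S(1) that] unfolding typical_seqs_uniform_iff[OF r] by blast+
    have "card {i \<in> {1..m}. x i = a} \<le> n div r" if "a < r" for a
    proof -
      have "seq_type m x a \<le> 1 / real r + \<epsilon>" using near[OF that] by linarith
      then have "real (card {i \<in> {1..m}. x i = a}) \<le> real m * (1 / real r + \<epsilon>)"
        using m unfolding seq_type_def by (simp add: divide_le_eq mult.commute)
      then show ?thesis using n by linarith
    qed
    moreover have "x i < r" if "i \<in> {1..m}" for i using x that by auto
    ultimately obtain p where "p permutes {1..n}" "\<And>i. i \<in> {1..m} \<Longrightarrow> p i mod r = x i"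
      using permutation_with_residues[of m n x r, OF m(2)] by blast
    then show ?thesis by blast
  qed
  then obtain h where h: "\<And>x. x \<in> S \<Longrightarrow> h x permutes {1..n}"
    "\<And>x i. x \<in> S \<Longrightarrow> i \<in> {1..m} \<Longrightarrow> h x i mod r = x i"
    by metis
  have hom: "graph_different G n (h x) (h y)"
    if xy: "x \<in> S" "y \<in> S" "graph_different M m x y" for x y
  proof -
    obtain i where i: "i \<in> {1..m}" "{x i, y i} \<in> M"
      using xy(3) unfolding graph_different_def by blast
    then have i': "i \<in> {1..n}" using m by auto
    then have "h x i \<ge> 1" "h y i \<ge> 1"
      using permutes_in_image[OF h(1)] xy by (meson atLeastAtMost_iff)+
    then have "{h x i, h y i} \<in> G" using residue_edge_iff h(2) xy i by simp
    then show ?thesis using i' unfolding graph_different_def by blast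
  qed
  show ?thesis
    using card_le_max_different_perms[of "h ` S" n G] h(1) card
      pairwise_card_image[of "graph_different M m" S "graph_different G n" h, OF S(2) hom G_irrefl]
    by auto
qed

section \<open>Supermultiplicativity and the lower limit\<close>

text \<open>Concatenating every member of one optimal family with every member of the other keeps
  distinct pairs different: pairs with different first components differ in the first block, all
  others in the second. A shift by a multiple of \<open>r\<close> preserves residues, so edges of
  \<open>G\<close> survive in the second block.\<close>

lemma max_different_perms_supermult:
  assumes N: "r dvd N"
  shows "max_different_perms G N * max_different_perms G n \<le> max_different_perms G (N + n)"
proof -
  obtain S where S: "S \<subseteq> {\<pi>. \<pi> permutes {1..N}}" "pairwise (graph_different G N) S"
    "card S = max_different_perms G N"
    by (rule max_different_perms_attained)
  obtain T where T: "T \<subseteq> {\<pi>. \<pi> permutes {1..n}}" "pairwise (graph_different G n) T"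
    "card T = max_different_perms G n"
    by (rule max_different_perms_attained)
  define h where "h = (\<lambda>(p, q) i. if i \<le> N then p i else N + q (i - N) :: nat)"
  \<comment> \<open>Difference of pairs: in at least one component. Distinct pairs from
    \<open>S \<times> T\<close> are always related.\<close>
  define P where "P = (\<lambda>(p, q) (p', q'). graph_different G N p p' \<or> graph_different G n q q')"
  have P: "pairwise P (S \<times> T)"
    using S(2) T(2) unfolding P_def pairwise_def by auto
  have sub: "h ` (S \<times> T) \<subseteq> {\<pi>. \<pi> permutes {1..N + n}}"
  proof (intro image_subsetI)
    fix u assume "u \<in> S \<times> T"
    then obtain p q where u: "u = (p, q)" "p permutes {1..N}" "q permutes {1..n}"
      using S(1) T(1) by auto
    show "h u \<in> {\<pi>. \<pi> permutes {1..N + n}}"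
      using permutes_concat[OF u(2,3)] unfolding h_def u(1) by simp
  qed
  have hom: "graph_different G (N + n) (h u) (h v)"
    if u: "u \<in> S \<times> T" and v: "v \<in> S \<times> T" and uv: "P u v" for u v
  proof -
    obtain p q p' q' where e: "u = (p, q)" "v = (p', q')" by (cases u, cases v)
    consider "graph_different G N p p'" | "graph_different G n q q'"
      using uv e unfolding P_def by auto
    then show ?thesis
    proof cases
      case 1
      then obtain i where "i \<in> {1..N}" "{p i, p' i} \<in> G" unfolding graph_different_def by blast
      then show ?thesis unfolding graph_different_def e h_def by (intro bexI[of _ i]) auto
    next
      case 2
      then obtain i where i: "i \<in> {1..n}" "{q i, q' i} \<in> G" unfolding graph_different_def by blast
      have "q permutes {1..n}" "q' permutes {1..n}" using u v e T(1) by auto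
      then have "q i \<ge> 1" "q' i \<ge> 1" using i(1) permutes_in_image by (metis atLeastAtMost_iff)+
      \<comment> \<open>This is where divisibility of \<open>N\<close> by \<open>r\<close>
        enters.\<close>
      moreover have "(N + k) mod r = k mod r" for k
        using N by (metis dvd_def mod_mult_self4)
      ultimately have "{N + q i, N + q' i} \<in> G" using i(2) residue_edge_iff by simp
      then show ?thesis using i(1) unfolding graph_different_def e h_def
        by (intro bexI[of _ "N + i"]) auto
    qed
  qed
  show ?thesis
    using card_le_max_different_perms[OF sub] S(3) T(3)
      pairwise_card_image[of P "S \<times> T" "graph_different G (N + n)" h, OF P hom G_irrefl]
    by (simp add: card_cartesian_product)
qed

text \<open>Blocks of length \<open>N\<close> are prepended one at a time to a tail of arbitrary
  length \<open>s\<close>, which contributes a factor of at least 1.\<close>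

lemma max_different_perms_power_le:
  assumes N: "r dvd N"
  shows "max_different_perms G N ^ k \<le> max_different_perms G (k * N + s)"
proof (induction k)
  case 0
  then show ?case using max_different_perms_ge_1 by simp
next
  case (Suc k)
  have "max_different_perms G N ^ Suc k \<le> max_different_perms G N * max_different_perms G (k * N + s)"
    using Suc by simp
  also have "\<dots> \<le> max_different_perms G (N + (k * N + s))"
    by (rule max_different_perms_supermult[OF N])
  finally show ?case by (simp add: algebra_simps)
qed

text \<open>A Fekete-type argument: for \<open>n = k * N + s\<close> with \<open>s < N\<close>, the
  family for \<open>N\<close> yields at least its \<open>k\<close>-th power at length
  \<open>n\<close>. Rounding \<open>n / N\<close> down to \<open>k\<close> costs at most
  \<open>l / n\<close> in the rate, which vanishes in the limit.\<close>

lemma perm_rate_le_liminf: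
  assumes N: "r dvd N" "N > 0"
  shows "ereal (perm_rate G N) \<le> liminf (\<lambda>n. ereal (perm_rate G n))"
proof -
  define l where "l = log 2 (real (max_different_perms G N))"
  have l: "l \<ge> 0" unfolding l_def by (rule log_max_different_perms_nonneg)
  have le: "l / real N - l / real n \<le> perm_rate G n" if n: "n > 0" for n
  proof -
    let ?k = "n div N"
    have "max_different_perms G N ^ ?k \<le> max_different_perms G n"
      using max_different_perms_power_le[OF N(1), of ?k "n mod N"] by simp
    then have "real (max_different_perms G N) ^ ?k \<le> real (max_different_perms G n)"
      by (metis of_nat_le_iff of_nat_power)
    moreover have pos: "real (max_different_perms G N) > 0"
      using max_different_perms_ge_1[of G N] by simp
    ultimately have "log 2 (real (max_different_perms G N) ^ ?k) \<le> log 2 (real (max_different_perms G n))"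
      by (intro log_mono) auto
    then have k: "real ?k * l \<le> log 2 (real (max_different_perms G n))"
      using pos unfolding l_def by (simp add: log_nat_power)
    have "real n / real N - 1 \<le> real ?k" using real_nat_div_bounds(2)[OF N(2), of n] by linarith
    then have "(real n / real N - 1) * l \<le> log 2 (real (max_different_perms G n))"
      using k mult_right_mono[OF _ l] by fastforce
    then have "(real n / real N - 1) * l / real n \<le> perm_rate G n"
      using n unfolding perm_rate_def by (simp add: divide_right_mono)
    also have "(real n / real N - 1) * l / real n = l / real N - l / real n"
      using n N by (simp add: field_simps)
    finally show ?thesis .
  qed
  have "(\<lambda>n. l / real N - l / real n) \<longlonglongrightarrow> l / real N - 0"
    by (intro tendsto_intros lim_const_over_n)
  then have "(\<lambda>n. ereal (l / real N - l / real n)) \<longlonglongrightarrow> ereal (l / real N)" by simp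
  then have "ereal (l / real N) = liminf (\<lambda>n. ereal (l / real N - l / real n))"
    by (intro lim_imp_Liminf[symmetric]) auto
  also have "\<dots> \<le> liminf (\<lambda>n. ereal (perm_rate G n))"
    by (rule Liminf_mono, rule eventually_mono[OF eventually_gt_at_top[of 0]]) (use le in simp)
  finally show ?thesis unfolding perm_rate_def l_def by simp
qed

section \<open>Passage to the limit\<close>

text \<open>For fixed \<epsilon> the comparison with sequences applies as soon as
  \<open>n \<ge> 1 / \<epsilon>\<close>, so it bounds the upper limit for every positive \<epsilon>,
  and the bound persists as \<epsilon> tends to 0.\<close>

lemma limsup_perm_rate_le:
  "limsup (\<lambda>n. ereal (perm_rate G n)) \<le> type_capacity {0..<r} M (pmf_of_set {0..<r})"
proof (rule tendsto_lowerbound[OF tendsto_type_capacity])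
  show "\<forall>\<^sub>F \<epsilon> in at_right 0. limsup (\<lambda>n. ereal (perm_rate G n)) \<le> limsup (\<lambda>n.
      ereal (1 / real n * log 2 (real (max_different_seqs {0..<r} M (pmf_of_set {0..<r}) \<epsilon> n))))"
    using eventually_at_right_less[of "0::real"]
  proof (rule eventually_mono)
    fix \<epsilon> :: real assume \<epsilon>: "0 < \<epsilon>"
    show "limsup (\<lambda>n. ereal (perm_rate G n)) \<le> limsup (\<lambda>n.
      ereal (1 / real n * log 2 (real (max_different_seqs {0..<r} M (pmf_of_set {0..<r}) \<epsilon> n))))"
    proof (rule Limsup_mono, rule eventually_mono[OF eventually_ge_at_top])
      fix n assume "nat \<lceil>1 / \<epsilon>\<rceil> \<le> n"
      then have "1 / \<epsilon> \<le> real n" by linarith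
      then have "1 \<le> real n * \<epsilon>" using \<epsilon> by (simp add: field_simps)
      then have "max_different_perms G n \<le> max_different_seqs {0..<r} M (pmf_of_set {0..<r}) \<epsilon> n"
        by (rule max_different_perms_le_seqs)
      then show "ereal (perm_rate G n) \<le>
        ereal (1 / real n * log 2 (real (max_different_seqs {0..<r} M (pmf_of_set {0..<r}) \<epsilon> n)))"
        using max_different_perms_ge_1[of G n] unfolding perm_rate_def
        by (auto intro!: divide_right_mono log_mono)
    qed
  qed
qed auto

text \<open>Sequences of length \<open>m\<close> lift to permutations of length
  \<open>r * K\<close>, which exceeds \<open>m\<close> by a factor of at most
  \<open>1 + r * \<epsilon> + r / m\<close>. As \<open>r * K\<close> is a multiple of
  \<open>r\<close>, the rate there is at most the lower limit \<open>l\<close>.\<close>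

lemma limsup_seqs_le:
  fixes \<epsilon> l :: real
  assumes \<epsilon>: "\<epsilon> > 0" and l: "liminf (\<lambda>n. ereal (perm_rate G n)) = ereal l"
  shows "limsup (\<lambda>m. ereal (1 / real m *
      log 2 (real (max_different_seqs {0..<r} M (pmf_of_set {0..<r}) \<epsilon> m)))) \<le> ereal ((1 + r * \<epsilon>) * l)"
proof -
  \<comment> \<open>The length \<open>r\<close> already gives a nonnegative rate below the lower
    limit.\<close>
  have l0: "0 \<le> l"
    using perm_rate_le_liminf[of r] l r log_max_different_perms_nonneg[of G r]
    unfolding perm_rate_def by (simp add: order_trans[rotated])
  have le: "1 / real m * log 2 (real (max_different_seqs {0..<r} M (pmf_of_set {0..<r}) \<epsilon> m))
      \<le> (1 + r * \<epsilon> + r / m) * l" (is "1 / _ * log 2 (real ?w) \<le> _") if m: "m > 0" for m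
  proof -
    \<comment> \<open>The least number of elements per residue class that suffices for all
      \<epsilon>-typical sequences of length \<open>m\<close> by the crude count;
      \<open>r * K div r = K\<close> then meets the lifting hypothesis. Rounding up accounts for the
      summand \<open>r / m\<close>.\<close>
    define K where "K = nat \<lceil>real m * (1 / real r + \<epsilon>)\<rceil>"
    have pos: "0 < real m * (1 / real r + \<epsilon>)" using m r \<epsilon> by (simp add: add_pos_pos)
    have K1: "real m * (1 / real r + \<epsilon>) \<le> real K" unfolding K_def by linarith
    have K2: "real K \<le> real m * (1 / real r + \<epsilon>) + 1" unfolding K_def using pos by linarith
    have K0: "K > 0" using K1 pos by linarith
    have "real r * (real m * (1 / real r + \<epsilon>)) = m + real r * \<epsilon> * m"
      using r by (simp add: field_simps)
    then have rK1: "m + real r * \<epsilon> * m \<le> real (r * K)" and rK2: "real (r * K) \<le> m + real r * \<epsilon> * m + r"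
      using mult_left_mono[OF K1, of "real r"] mult_left_mono[OF K2, of "real r"]
      unfolding of_nat_mult distrib_left mult_1_right by linarith+
    have "0 \<le> real r * \<epsilon> * m" using \<epsilon> by simp
    then have mK: "m \<le> r * K" using rK1 by linarith
    have w: "?w \<le> max_different_perms G (r * K)"
      using max_different_seqs_le_perms[OF m mK] K1 r by simp
    have "log 2 (real ?w) \<le> log 2 (real (max_different_perms G (r * K)))"
    \<comment> \<open>For small \<open>m\<close> there may be no typical sequence at all; then the
      convention \<open>log 2 0 = 0\<close> applies.\<close>
    proof (cases "?w = 0")
      case True
      then show ?thesis using log_max_different_perms_nonneg by (simp add: log_def)
    next
      case False
      then show ?thesis using w by (intro log_mono) auto
    qed
    also have "\<dots> \<le> real (r * K) * l"
      using perm_rate_le_liminf[of "r * K"] r K0 l unfolding perm_rate_def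
      by (simp add: divide_le_eq mult_ac)
    also have "\<dots> \<le> (m + real r * \<epsilon> * m + r) * l" using rK2 l0 by (rule mult_right_mono)
    finally have "log 2 (real ?w) / m \<le> (m + real r * \<epsilon> * m + r) * l / m"
      by (simp add: divide_right_mono)
    also have "\<dots> = (1 + r * \<epsilon> + r / m) * l" using m by (simp add: field_simps)
    finally show ?thesis by simp
  qed
  have "(\<lambda>m. (1 + r * \<epsilon> + r / m) * l) \<longlonglongrightarrow> (1 + r * \<epsilon> + 0) * l"
    by (intro tendsto_intros lim_const_over_n)
  then have "(\<lambda>m. ereal ((1 + r * \<epsilon> + r / m) * l)) \<longlonglongrightarrow> ereal ((1 + r * \<epsilon>) * l)" by simp
  then have "limsup (\<lambda>m. ereal ((1 + r * \<epsilon> + r / m) * l)) = ereal ((1 + r * \<epsilon>) * l)"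
    by (intro lim_imp_Limsup) auto
  moreover have "limsup (\<lambda>m. ereal (1 / real m *
      log 2 (real (max_different_seqs {0..<r} M (pmf_of_set {0..<r}) \<epsilon> m))))
      \<le> limsup (\<lambda>m. ereal ((1 + r * \<epsilon> + r / m) * l))"
    by (rule Limsup_mono, rule eventually_mono[OF eventually_gt_at_top[of 0]]) (use le in simp)
  ultimately show ?thesis by simp
qed

text \<open>When the lower limit is a real \<open>l\<close>, the bound
  \<open>(1 + r * \<epsilon>) * l\<close> tends to \<open>l\<close> with \<epsilon>. An infinite
  lower limit leaves nothing to show, and minus infinity is excluded by the real rate at length
  \<open>r\<close>.\<close>

lemma type_capacity_le_liminf:
  "type_capacity {0..<r} M (pmf_of_set {0..<r}) \<le> liminf (\<lambda>n. ereal (perm_rate G n))"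
proof (cases "liminf (\<lambda>n. ereal (perm_rate G n))")
  case (real l)
  have "((\<lambda>\<epsilon>. (1 + real r * \<epsilon>) * l) \<longlongrightarrow> (1 + real r * 0) * l) (at_right 0)"
    by (intro tendsto_intros)
  then have lim: "((\<lambda>\<epsilon>. ereal ((1 + real r * \<epsilon>) * l)) \<longlongrightarrow> ereal l) (at_right 0)" by simp
  have "type_capacity {0..<r} M (pmf_of_set {0..<r}) \<le> ereal l"
    by (rule tendsto_le[OF _ lim tendsto_type_capacity])
      (use limsup_seqs_le[OF _ real] eventually_at_right_less[of "0::real"]
        in \<open>auto elim: eventually_mono\<close>)
  then show ?thesis using real by simp
next
  case MInf
  then show ?thesis using perm_rate_le_liminf[of r] r by simp
qed simp

end

theorem theorem4:
  fixes G M :: "nat set set" and r :: nat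
  assumes "r > 0"
    and "residue_graph G r M"
  shows "(\<lambda>n. ereal (1 / real n * log 2 (real (max_different_perms G n))))
    \<longlonglongrightarrow> type_capacity {0..<r} M (pmf_of_set {0..<r})"
proof -
  let ?t = "\<lambda>n. ereal (1 / real n * log 2 (real (max_different_perms G n)))"
  let ?C = "type_capacity {0..<r} M (pmf_of_set {0..<r})"
  \<comment> \<open>With \<open>liminf ?t \<le> limsup ?t\<close> these two bounds close a cycle of
    inequalities, so the limit exists and equals the capacity.\<close>
  have "limsup ?t \<le> ?C" "?C \<le> liminf ?t"
    using limsup_perm_rate_le[OF assms] type_capacity_le_liminf[OF assms]
    by (simp_all add: perm_rate_def)
  moreover have "liminf ?t \<le> limsup ?t" by (rule Liminf_le_Limsup) simp
  ultimately have "liminf ?t = ?C" "limsup ?t = ?C" by auto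
  then show ?thesis by (simp add: tendsto_iff_Liminf_eq_Limsup)
qed

end
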